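(* Let $S$ be a (complex) spin factor, $F$ an anisotropic Jordan Banach triple and $T:S\to F$ a generalised triple homomorphism. Then $T$ is continuous.
   Context: A complex (resp. real) Jordan Banach triple is a complex (resp. real) Banach space $E$ with a continuous triple product $\{\cdot,\cdot,\cdot\}:E^3\to E$ that is bilinear and symmetric in the outer variables and conjugate linear (resp. linear) in the middle one, satisfying the Jordan identity $L(a,b)L(x,y)-L(x,y)L(a,b)=L(L(a,b)x,y)-L(x,L(b,a)y)$, where $L(x,y)z=\{x,y,z\}$. It is anisotropic if $\{a,a,a\}=0$ implies $a=0$. A (complex) spin factor is a complex Hilbert space $S$, with inner product $(\cdot|\cdot)$ (linear in the first variable), provided with a conjugation $x\mapsto\overline{x}$ (a conjugate-linear isometry of period 2), the triple product $\{a,b,c\}=\frac12\big((a|b)c+(c|b)a-(a|\overline{c})\overline{b}\big)$, and the norm given by $\|a\|^2=\frac12(a|a)+\frac12\sqrt{(a|a)^2-|(a|\overline a)|^2}$. A (not necessarily continuous) linear mapping $T:E\to F$ between Jordan Banach triples is a generalised triple homomorphism if there is $C>0$ with $\|T(\{a,b,c\})-\{T(a),T(b),T(c)\}\|\le C\|a\|\|b\|\|c\|$ for all $a,b,c\in E$. *)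

theory Defs
  imports "HOL-Analysis.Analysis"
begin

text \<open>
  Complex Banach and Hilbert spaces are not in the library.  A complex scalar multiplication is
  an explicit parameter \<open>sc\<close>, required to extend the real one of the type class.
\<close>

locale complex_banach_space = vector_space sc
  for sc :: "complex \<Rightarrow> 'a::banach \<Rightarrow> 'a" +
  assumes sc_of_real: "sc (complex_of_real r) x = r *\<^sub>R x"
    and norm_sc: "norm (sc k x) = cmod k * norm x"

definition conjugate_linear ::
    "(complex \<Rightarrow> 'a \<Rightarrow> 'a) \<Rightarrow> (complex \<Rightarrow> 'b \<Rightarrow> 'b) \<Rightarrow> ('a::ab_group_add \<Rightarrow> 'b::ab_group_add) \<Rightarrow> bool"
  where "conjugate_linear sc1 sc2 f \<longleftrightarrow>
    (\<forall>x y. f (x + y) = f x + f y) \<and> (\<forall>k x. f (sc1 k x) = sc2 (cnj k) (f x))"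

text \<open>
  The Hilbert norm is kept apart from the type class norm: on a spin factor the latter is the
  spin norm, which is equivalent but not equal to it.
\<close>

definition hilbert_norm :: "('a \<Rightarrow> 'a \<Rightarrow> complex) \<Rightarrow> 'a \<Rightarrow> real"
  where "hilbert_norm ip x = sqrt (Re (ip x x))"

locale complex_hilbert_space = vector_space sc
  for sc :: "complex \<Rightarrow> 'a::ab_group_add \<Rightarrow> 'a" +
  fixes ip :: "'a \<Rightarrow> 'a \<Rightarrow> complex"
  assumes ip_linear_left: "Vector_Spaces.linear sc (*) (\<lambda>x. ip x y)"
    and ip_hermitian: "ip y x = cnj (ip x y)"
    and ip_pos: "x \<noteq> 0 \<Longrightarrow> 0 < Re (ip x x)"
    and ip_complete:
      "(\<And>e. 0 < e \<Longrightarrow> \<exists>M. \<forall>m\<ge>M. \<forall>n\<ge>M. hilbert_norm ip (X m - X n) < e) \<Longrightarrow>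
       \<exists>l. (\<lambda>n. hilbert_norm ip (X n - l)) \<longlonglongrightarrow> 0"

locale spin_factor = complex_banach_space sc + complex_hilbert_space sc ip
  for sc :: "complex \<Rightarrow> 'a::banach \<Rightarrow> 'a" and ip :: "'a \<Rightarrow> 'a \<Rightarrow> complex" +
  fixes cj :: "'a \<Rightarrow> 'a"
  assumes cj_conjugate_linear: "conjugate_linear sc sc cj"
    and cj_isometry: "hilbert_norm ip (cj x) = hilbert_norm ip x"
    and cj_cj: "cj (cj x) = x"
    and spin_norm: "(norm a)\<^sup>2 =
      1/2 * Re (ip a a) + 1/2 * sqrt ((Re (ip a a))\<^sup>2 - (cmod (ip a (cj a)))\<^sup>2)"

definition spin_triple ::
    "(complex \<Rightarrow> 'a \<Rightarrow> 'a) \<Rightarrow> ('a \<Rightarrow> 'a \<Rightarrow> complex) \<Rightarrow> ('a \<Rightarrow> 'a) \<Rightarrow> 'a \<Rightarrow> 'a \<Rightarrow> 'a \<Rightarrow> 'a::ab_group_add"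
  where "spin_triple sc ip cj a b c =
    sc (1/2) (sc (ip a b) c + sc (ip c b) a - sc (ip a (cj c)) (cj b))"

locale jordan_banach_triple_base =
  fixes tp :: "'a::banach \<Rightarrow> 'a \<Rightarrow> 'a \<Rightarrow> 'a"
  assumes tp_symmetric: "tp a b c = tp c b a"
    and tp_continuous: "continuous_on UNIV (\<lambda>(a, b, c). tp a b c)"
    and tp_jordan:
      "tp a b (tp x y z) - tp x y (tp a b z) = tp (tp a b x) y z - tp x (tp b a y) z"

text \<open>Linearity in the third variable follows from linearity in the first one and symmetry.\<close>

locale real_jordan_banach_triple = jordan_banach_triple_base tp
  for tp :: "'a::banach \<Rightarrow> 'a \<Rightarrow> 'a \<Rightarrow> 'a" +
  assumes tp_linear_outer: "linear (\<lambda>a. tp a b c)"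
    and tp_linear_middle: "linear (\<lambda>b. tp a b c)"

locale complex_jordan_banach_triple = complex_banach_space sc + jordan_banach_triple_base tp
  for sc :: "complex \<Rightarrow> 'a::banach \<Rightarrow> 'a" and tp :: "'a \<Rightarrow> 'a \<Rightarrow> 'a \<Rightarrow> 'a" +
  assumes tp_linear_outer: "Vector_Spaces.linear sc sc (\<lambda>a. tp a b c)"
    and tp_conjugate_linear_middle: "conjugate_linear sc sc (\<lambda>b. tp a b c)"

definition anisotropic :: "('a \<Rightarrow> 'a \<Rightarrow> 'a \<Rightarrow> 'a::zero) \<Rightarrow> bool"
  where "anisotropic tp \<longleftrightarrow> (\<forall>a. tp a a a = 0 \<longrightarrow> a = 0)"

text \<open>
  The scalar multiplications are parameters, so that the same definition serves real-linear
  mappings (both equal to \<open>scaleR\<close>) and complex-linear ones.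
\<close>

definition generalised_triple_homomorphism ::
    "('k::field \<Rightarrow> 'a \<Rightarrow> 'a) \<Rightarrow> ('a \<Rightarrow> 'a \<Rightarrow> 'a \<Rightarrow> 'a) \<Rightarrow>
     ('k \<Rightarrow> 'b \<Rightarrow> 'b) \<Rightarrow> ('b \<Rightarrow> 'b \<Rightarrow> 'b \<Rightarrow> 'b) \<Rightarrow>
     ('a::banach \<Rightarrow> 'b::banach) \<Rightarrow> bool"
  where "generalised_triple_homomorphism scE tpE scF tpF T \<longleftrightarrow>
    Vector_Spaces.linear scE scF T \<and>
    (\<exists>C>0. \<forall>a b c. norm (T (tpE a b c) - tpF (T a) (T b) (T c)) \<le> C * norm a * norm b * norm c)"

end

theory Submission
  imports Defs
begin

text \<open>
  By the closed graph theorem it suffices that \<open>y = 0\<close> whenever \<open>x n \<longlonglongrightarrow> 0\<close> and \<open>T (x n) \<longlonglongrightarrow> y\<close>.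
  The triple product of a spin factor lies in the span of its outer arguments and the conjugate of
  the middle one, with small coefficients when the outer arguments are small.  Hence
  \<open>T {x n, b, x m}\<close> tends to \<open>0\<close> (first \<open>n\<close>, then \<open>m\<close>) for fixed \<open>b\<close>, so that \<open>{y, T b, y} = 0\<close> for all \<open>b\<close>.  Choosing
  \<open>b = x m\<close> and letting \<open>m\<close> tend to infinity gives \<open>{y, y, y} = 0\<close>, and anisotropy applies.
\<close>

section \<open>The closed graph theorem\<close>

text \<open>Baire category: the closures of the sublevel sets of \<open>norm (f x)\<close> cover the
  complete space, so one of them contains a ball around some \<open>c\<close>. Subtracting
  approximants of \<open>c + x\<close> and \<open>c\<close> moves this ball to the origin and
  doubles the bound.\<close>

lemma linear_sublevel_dense_in_ball:
  fixes f :: "'a::banach \<Rightarrow> 'b::real_normed_vector"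
  assumes "linear f"
  obtains K r where "0 \<le> K" "0 < r"
    "\<And>x e. norm x < r \<Longrightarrow> 0 < e \<Longrightarrow> \<exists>u. norm (f u) \<le> K \<and> norm (x - u) < e"
proof -
  interpret linear f by fact
  define B where "B k = closure {x. norm (f x) \<le> real k}" for k :: nat
  have "x \<in> \<Union>(range B)" for x
  proof -
    obtain k :: nat where "norm (f x) \<le> real k"
      using real_arch_simple by blast
    then have "x \<in> B k"
      unfolding B_def by (intro closure_subset[THEN subsetD]) simp
    then show ?thesis
      by blast
  qed
  then have "\<Union>(range B) = UNIV"
    by blast
  moreover have "interior (\<Union>(range B)) = {}" if "\<And>k. interior (B k) = {}"
  proof -
    have "Met_TC.mtopology interior_of \<Union>(range B) = {}"
      by (rule Met_TC.metric_Baire_category_alt)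
        (use that in \<open>auto simp: complete_UNIV B_def\<close>)
    then show ?thesis
      by simp
  qed
  ultimately have "\<exists>k. interior (B k) \<noteq> {}"
    by (metis UNIV_not_empty interior_UNIV)
  then obtain k c where "c \<in> interior (B k)"
    by blast
  then obtain r where r: "0 < r" "ball c r \<subseteq> B k"
    using mem_interior by blast
  have approx: "\<exists>u. norm (f u) \<le> real k \<and> norm (z - u) < e" if "z \<in> B k" "0 < e" for z e
    using that unfolding B_def closure_approachable by (auto simp: dist_norm norm_minus_commute)
  have "\<exists>u. norm (f u) \<le> 2 * real k \<and> norm (x - u) < e" if "norm x < r" "0 < e" for x e
  proof -
    have "c + x \<in> B k" "c \<in> B k"
      using r that by (auto simp: dist_norm subset_iff)
    then obtain u v where uv: "norm (f u) \<le> real k" "norm (c + x - u) < e / 2"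
        "norm (f v) \<le> real k" "norm (c - v) < e / 2"
      using approx \<open>0 < e\<close> half_gt_zero by metis
    have "norm (f (u - v)) \<le> 2 * real k"
      using uv norm_triangle_ineq4[of "f u" "f v"] by (simp add: diff)
    moreover have "norm (x - (u - v)) < e"
      using uv norm_triangle_ineq4[of "c + x - u" "c - v"] by (simp add: algebra_simps)
    ultimately show ?thesis
      by blast
  qed
  then show thesis
    using that[of "2 * real k" r] r by simp
qed

text \<open>Successive approximation, as for the open mapping theorem: sublevel density, rescaled,
  approximates each \<open>x\<close> up to half its norm by a vector with controlled image, and
  iterating on the remainders expands \<open>f x\<close> into a series with a geometric majorant.
  For linear \<open>f\<close>, closedness of the graph amounts to the condition at
  \<open>0\<close>.\<close>

theorem closed_graph:
  fixes f :: "'a::banach \<Rightarrow> 'b::banach"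
  assumes "linear f"
    and closed: "\<And>x y. x \<longlonglongrightarrow> 0 \<Longrightarrow> (\<lambda>n. f (x n)) \<longlonglongrightarrow> y \<Longrightarrow> y = 0"
  shows "bounded_linear f"
proof -
  interpret linear f by fact
  obtain K r where K: "0 \<le> K" and r: "0 < r"
    and dense: "\<And>x e. norm x < r \<Longrightarrow> 0 < e \<Longrightarrow> \<exists>u. norm (f u) \<le> K \<and> norm (x - u) < e"
    using linear_sublevel_dense_in_ball[OF \<open>linear f\<close>] by metis
  define M where "M = 2 * K / r"
  have "\<exists>u. norm (f u) \<le> M * norm x \<and> norm (x - u) \<le> norm x / 2" for x
  proof (cases "x = 0")
    case True
    then show ?thesis
      by (intro exI[of _ 0]) simp
  next
    case False
    \<comment> \<open>The vector \<open>s *\<^sub>R x\<close> has norm \<open>r / 2\<close>, inside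
      the ball. Dividing by \<open>s\<close> turns the bound \<open>K\<close> into
      \<open>M * norm x\<close> and the error \<open>r / 4\<close> into
      \<open>norm x / 2\<close>.\<close>
    define s where "s = r / (2 * norm x)"
    have s: "0 < s"
      using False r by (simp add: s_def)
    have "norm (s *\<^sub>R x) < r"
      using False r by (simp add: s_def)
    then obtain u where u: "norm (f u) \<le> K" "norm (s *\<^sub>R x - u) < r / 4"
      using dense r by (meson divide_pos_pos zero_less_numeral)
    have "norm (f (inverse s *\<^sub>R u)) = norm (f u) / s"
      using s by (simp add: scale divide_simps)
    also have "\<dots> \<le> K / s"
      using u s by (intro divide_right_mono) auto
    also have "\<dots> = M * norm x"
      by (simp add: s_def M_def)
    finally have 1: "norm (f (inverse s *\<^sub>R u)) \<le> M * norm x" .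
    have "x - inverse s *\<^sub>R u = inverse s *\<^sub>R (s *\<^sub>R x - u)"
      using s by (simp add: scaleR_diff_right)
    then have "norm (x - inverse s *\<^sub>R u) = norm (s *\<^sub>R x - u) / s"
      using s by (simp add: divide_simps)
    also have "\<dots> \<le> (r / 4) / s"
      using u s by (intro divide_right_mono) auto
    also have "\<dots> = norm x / 2"
      using r by (simp add: s_def)
    finally show ?thesis
      using 1 by blast
  qed
  then obtain g where g: "\<And>x. norm (f (g x)) \<le> M * norm x" "\<And>x. norm (x - g x) \<le> norm x / 2"
    by metis
  have M: "0 \<le> M"
    using K r by (simp add: M_def)
  have "norm (f x) \<le> norm x * (2 * M)" for x
  proof -
    \<comment> \<open>\<open>X n\<close> is the remainder after \<open>n\<close> approximation
      steps.\<close>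
    define X where "X n = ((\<lambda>x. x - g x) ^^ n) x" for n
    have X_Suc: "X (Suc n) = X n - g (X n)" for n
      by (simp add: X_def)
    have X: "norm (X n) \<le> norm x * (1/2) ^ n" for n
    proof (induction n)
      case (Suc n)
      then show ?case
        using g(2)[of "X n"] by (simp add: X_Suc)
    qed (simp add: X_def)
    have geo: "(\<lambda>n. norm x * (1/2) ^ n) \<longlonglongrightarrow> 0"
      by (intro tendsto_mult_right_zero LIMSEQ_power_zero) simp
    have X0: "X \<longlonglongrightarrow> 0"
      by (rule Lim_null_comparison[OF _ geo]) (simp add: X)
    have bound: "norm (f (g (X n))) \<le> (M * norm x) * (1/2) ^ n" for n
      using order_trans[OF g(1)[of "X n"] mult_left_mono[OF X M, of n]] by (simp add: mult.assoc)
    have sums: "(\<lambda>n. (M * norm x) * (1/2) ^ n) sums (M * norm x * 2)"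
      using sums_mult[OF geometric_sums[of "1/2::real"], of "M * norm x"] by simp
    have summable: "summable (\<lambda>n. f (g (X n)))"
      by (rule summable_comparison_test'[OF sums_summable[OF sums] bound])
    have partial: "f (X n) = f x - (\<Sum>i<n. f (g (X i)))" for n
    proof (induction n)
      case (Suc n)
      then show ?case
        by (simp add: X_Suc diff)
    qed (simp add: X_def)
    have "(\<lambda>n. f (X n)) \<longlonglongrightarrow> f x - (\<Sum>n. f (g (X n)))"
      unfolding partial by (intro tendsto_diff tendsto_const summable_LIMSEQ summable)
    \<comment> \<open>The remainders tend to \<open>0\<close> and their images converge, so
      \<open>closed\<close> makes the limit of the images vanish.\<close>
    then have "f x = (\<Sum>n. f (g (X n)))"
      using closed[OF X0] by fastforce
    also have "norm \<dots> \<le> (\<Sum>n. (M * norm x) * (1/2) ^ n)"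
      by (rule norm_suminf_le) (use bound sums_summable[OF sums] in auto)
    also have "\<dots> = norm x * (2 * M)"
      by (simp flip: sums_unique[OF sums])
    finally show ?thesis .
  qed
  then show ?thesis
    by (intro bounded_linear_intro[of _ "2 * M"]) (simp_all add: add scale)
qed

section \<open>Spin factors\<close>

context complex_banach_space
begin

lemma sc_real_imag: "sc k x = Re k *\<^sub>R x + Im k *\<^sub>R sc \<i> x"
proof -
  have "sc k x = sc (of_real (Re k) + of_real (Im k) * \<i>) x"
    by (simp add: complex_eq_iff)
  then show ?thesis
    unfolding scale_left_distrib scale_scale[symmetric] sc_of_real .
qed

lemma real_linear_sc:
  assumes "linear T"
  shows "T (sc k x) = Re k *\<^sub>R T x + Im k *\<^sub>R T (sc \<i> x)"
  by (subst sc_real_imag) (simp add: linear_add[OF assms] linear_cmul[OF assms])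

end

lemma complex_linear_imp_linear:
  assumes "complex_banach_space sc1" "complex_banach_space sc2" "Vector_Spaces.linear sc1 sc2 T"
  shows "linear T"
proof (rule linearI)
  show "T (x + y) = T x + T y" for x y
    using assms(3) by (simp add: Vector_Spaces.linear_iff)
  show "T (r *\<^sub>R x) = r *\<^sub>R T x" for r x
    using assms(3) complex_banach_space.sc_of_real[OF assms(1)]
      complex_banach_space.sc_of_real[OF assms(2)]
    by (metis Vector_Spaces.linear_iff)
qed

section \<open>Inner products and the Cauchy-Schwarz inequality\<close>

context complex_hilbert_space
begin

lemma ip_diff_left: "ip (x - y) z = ip x z - ip y z"
proof -
  interpret Vector_Spaces.linear sc "(*)" "\<lambda>x. ip x z"
    by (rule ip_linear_left)
  show ?thesis
    by (rule diff)
qed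

lemma ip_scale_left: "ip (sc k x) z = k * ip x z"
  using ip_linear_left[of z] by (simp add: Vector_Spaces.linear_iff)

lemma ip_zero_left: "ip 0 z = 0"
  using ip_diff_left[of 0 0 z] by simp

lemma ip_diff_right: "ip z (x - y) = ip z x - ip z y"
  unfolding ip_hermitian[of z] by (simp add: ip_diff_left)

lemma ip_scale_right: "ip z (sc k x) = cnj k * ip z x"
  unfolding ip_hermitian[of z] by (simp add: ip_scale_left)

lemma ip_self: "ip x x = complex_of_real (Re (ip x x))"
  using ip_hermitian[of x x] by (simp add: complex_eq_iff)

lemma ip_self_nonneg: "0 \<le> Re (ip x x)"
  using ip_pos[of x] ip_zero_left[of x] by (cases "x = 0") auto

lemma Cauchy_Schwarz: "(cmod (ip x y))\<^sup>2 \<le> Re (ip x x) * Re (ip y y)"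
proof (cases "y = 0")
  case True
  then show ?thesis
    using ip_hermitian[of x 0] by (simp add: ip_zero_left)
next
  case False
  define b where "b = Re (ip y y)"
  have b: "0 < b" "ip y y = of_real b"
    using ip_pos[OF False] ip_self[of y] by (auto simp: b_def)
  \<comment> \<open>\<open>sc k y\<close> is the orthogonal projection of \<open>x\<close> onto the
    line spanned by \<open>y\<close>.\<close>
  define k where "k = ip x y / of_real b"
  have yx: "ip y x = cnj (ip x y)"
    by (rule ip_hermitian)
  have "0 \<le> Re (ip (x - sc k y) (x - sc k y))"
    by (rule ip_self_nonneg)
  also have "ip (x - sc k y) (x - sc k y) =
      ip x x - cnj k * ip x y - (k * cnj (ip x y) - k * (cnj k * of_real b))"
    by (simp add: ip_diff_left ip_diff_right ip_scale_left ip_scale_right yx b(2) algebra_simps)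
  also have "\<dots> = ip x x - of_real ((cmod (ip x y))\<^sup>2 / b)"
    using b(1) by (simp add: k_def complex_norm_square field_simps del: of_real_power)
  finally show ?thesis
    using b(1) by (simp add: b_def field_simps)
qed

end

section \<open>Continuity of the inner product in the spin norm, and the separating space\<close>

context spin_factor
begin

lemma ip_self_le: "Re (ip x x) \<le> 2 * (norm x)\<^sup>2"
proof -
  have "Re (ip (cj x) (cj x)) = Re (ip x x)"
    using cj_isometry[of x] by (simp add: hilbert_norm_def)
  then have "(cmod (ip x (cj x)))\<^sup>2 \<le> (Re (ip x x))\<^sup>2"
    using Cauchy_Schwarz[of x "cj x"] by (simp add: power2_eq_square)
  then show ?thesis
    using spin_norm[of x] by simp
qed

lemma ip_bound: "cmod (ip x y) \<le> 2 * norm x * norm y"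
proof (rule power2_le_imp_le)
  have "(cmod (ip x y))\<^sup>2 \<le> (2 * (norm x)\<^sup>2) * (2 * (norm y)\<^sup>2)"
    by (intro order_trans[OF Cauchy_Schwarz] mult_mono ip_self_le ip_self_nonneg) simp
  then show "(cmod (ip x y))\<^sup>2 \<le> (2 * norm x * norm y)\<^sup>2"
    by (simp add: power_mult_distrib)
qed simp

lemma tendsto_ip_left:
  assumes "x \<longlonglongrightarrow> 0"
  shows "(\<lambda>n. ip (x n) b) \<longlonglongrightarrow> 0"
proof (rule Lim_null_comparison)
  show "\<forall>\<^sub>F n in sequentially. norm (ip (x n) b) \<le> 2 * norm (x n) * norm b"
    by (simp add: ip_bound)
  show "(\<lambda>n. 2 * norm (x n) * norm b) \<longlonglongrightarrow> 0"
    using assms by (auto intro!: tendsto_eq_intros)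
qed

text \<open>
  For a real Jordan triple \<open>F\<close> the map \<open>T\<close> is only real-linear, so \<open>T (sc \<i> (x n))\<close> is not under
  control a priori.  The estimate for \<open>{x n, b, c}\<close> with \<open>ip c b = \<i>\<close> forces it to converge.
\<close>

lemma separating_space_trivial:
  fixes T :: "'a \<Rightarrow> 'b::banach"
  assumes "linear T" "anisotropic tp"
    and cont: "continuous_on UNIV (\<lambda>(a, b, c). tp a b c)"
    and C: "\<And>a b c. norm (T (spin_triple sc ip cj a b c) - tp (T a) (T b) (T c))
              \<le> C * norm a * norm b * norm c"
    and x: "x \<longlonglongrightarrow> 0" and Tx: "(\<lambda>n. T (x n)) \<longlonglongrightarrow> y"
  shows "y = 0"
\<comment> \<open>A nonzero vector serves below to give the inner product the value
  \<open>\<i>\<close>.\<close>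
proof (cases "\<exists>c::'a. c \<noteq> 0")
  case False
  then have "T (x n) = 0" for n
    using False linear_0[OF \<open>linear T\<close>] by (metis (full_types))
  then show ?thesis
    using Tx by (simp add: LIMSEQ_const_iff)
next
  case True
  interpret T: linear T by fact
  note T_sc = real_linear_sc[OF \<open>linear T\<close>]
  have tp: "(\<lambda>n. tp (X n) (Y n) (Z n)) \<longlonglongrightarrow> tp a b c"
    if "X \<longlonglongrightarrow> a" "Y \<longlonglongrightarrow> b" "Z \<longlonglongrightarrow> c" for X Y Z a b c
    using continuous_on_tendsto_compose[OF cont tendsto_Pair[OF that(1) tendsto_Pair[OF that(2,3)]]]
    by simp
  \<comment> \<open>\<open>T\<close> is not known to be continuous, but its restriction to the
    complex line through a fixed \<open>v\<close> is.\<close>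
  have coeff: "(\<lambda>n. T (sc (k n) v)) \<longlonglongrightarrow> 0" if "k \<longlonglongrightarrow> 0" for k v
  proof -
    have "(\<lambda>n. Re (k n) *\<^sub>R T v + Im (k n) *\<^sub>R T (sc \<i> v)) \<longlonglongrightarrow> 0"
      using that by (auto intro!: tendsto_eq_intros)
    then show ?thesis
      unfolding T_sc[of "k _" v, symmetric] .
  qed
  \<comment> \<open>In \<open>{x n, b, c}\<close> two of the three terms are small multiples of the
    fixed vectors \<open>c\<close> and \<open>cj b\<close>, so their images vanish in the limit by
    \<open>coeff\<close>. Only the multiple of \<open>x n\<close> remains.\<close>
  have key: "(\<lambda>n. T (sc (ip c b) (x n))) \<longlonglongrightarrow> 2 *\<^sub>R tp y (T b) (T c)" for b c
  proof -
    define D where "D n = T (spin_triple sc ip cj (x n) b c) - tp (T (x n)) (T b) (T c)" for n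
    have D: "D \<longlonglongrightarrow> 0"
    proof (rule Lim_null_comparison)
      show "\<forall>\<^sub>F n in sequentially. norm (D n) \<le> C * norm (x n) * norm b * norm c"
        by (simp add: C D_def)
      show "(\<lambda>n. C * norm (x n) * norm b * norm c) \<longlonglongrightarrow> 0"
        using x by (auto intro!: tendsto_eq_intros)
    qed
    have half: "sc (1/2) v = (1/2) *\<^sub>R v" for v
      using sc_of_real[of "1/2" v] by simp
    have "T (sc (ip c b) (x n)) = 2 *\<^sub>R (D n + tp (T (x n)) (T b) (T c))
        - T (sc (ip (x n) b) c) + T (sc (ip (x n) (cj c)) (cj b))" for n
      unfolding D_def spin_triple_def half T.scale T.diff T.add by simp
    moreover have "(\<lambda>n. 2 *\<^sub>R (D n + tp (T (x n)) (T b) (T c))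
        - T (sc (ip (x n) b) c) + T (sc (ip (x n) (cj c)) (cj b)))
        \<longlonglongrightarrow> 2 *\<^sub>R (0 + tp y (T b) (T c)) - 0 + 0"
      by (intro tendsto_intros D tp Tx coeff tendsto_ip_left x)
    ultimately show ?thesis
      by simp
  qed
  obtain c0 :: 'a where c0: "c0 \<noteq> 0"
    using True by blast
  then have "ip c0 c0 \<noteq> 0"
    using ip_pos by fastforce
  \<comment> \<open>The scalar is conjugated because \<open>ip\<close> is conjugate linear in its
    second argument.\<close>
  then have i: "ip c0 (sc (cnj (\<i> / ip c0 c0)) c0) = \<i>"
    unfolding ip_scale_right by simp
  obtain w where w: "(\<lambda>n. T (sc \<i> (x n))) \<longlonglongrightarrow> w"
    using key[of c0 "sc (cnj (\<i> / ip c0 c0)) c0"] unfolding i by blast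
  have eq: "2 *\<^sub>R tp y (T b) (T c) = Re (ip c b) *\<^sub>R y + Im (ip c b) *\<^sub>R w" for b c
  proof (rule LIMSEQ_unique[OF key])
    show "(\<lambda>n. T (sc (ip c b) (x n))) \<longlonglongrightarrow> Re (ip c b) *\<^sub>R y + Im (ip c b) *\<^sub>R w"
      unfolding T_sc[of "ip c b"] by (intro tendsto_intros Tx w)
  qed
  \<comment> \<open>Put \<open>c = x m\<close> in \<open>eq\<close>: both coefficients on the right
    tend to \<open>0\<close>, while \<open>T (x m)\<close> on the left tends to
    \<open>y\<close>.\<close>
  have "2 *\<^sub>R tp y (T b) y = 0" for b
  proof (rule LIMSEQ_unique)
    show "(\<lambda>m. 2 *\<^sub>R tp y (T b) (T (x m))) \<longlonglongrightarrow> 2 *\<^sub>R tp y (T b) y"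
      by (intro tendsto_intros tp Tx)
    show "(\<lambda>m. 2 *\<^sub>R tp y (T b) (T (x m))) \<longlonglongrightarrow> 0"
      unfolding eq by (auto intro!: tendsto_eq_intros tendsto_ip_left x)
  qed
  then have "(\<lambda>m. tp y (T (x m)) y) = (\<lambda>m. 0)"
    by simp
  moreover have "(\<lambda>m. tp y (T (x m)) y) \<longlonglongrightarrow> tp y y y"
    by (intro tp Tx tendsto_const)
  ultimately have "tp y y y = 0"
    by (simp add: LIMSEQ_const_iff)
  then show ?thesis
    using \<open>anisotropic tp\<close> unfolding anisotropic_def by blast
qed

end

theorem lemma16:
  fixes scS :: "complex \<Rightarrow> 'a::banach \<Rightarrow> 'a"
    and ip :: "'a \<Rightarrow> 'a \<Rightarrow> complex"
    and cj :: "'a \<Rightarrow> 'a"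
    and scF :: "complex \<Rightarrow> 'b::banach \<Rightarrow> 'b"
    and tpF :: "'b \<Rightarrow> 'b \<Rightarrow> 'b \<Rightarrow> 'b"
    and T :: "'a \<Rightarrow> 'b"
  assumes "spin_factor scS ip cj"
    and "anisotropic tpF"
    and "(complex_jordan_banach_triple scF tpF \<and>
            generalised_triple_homomorphism scS (spin_triple scS ip cj) scF tpF T) \<or>
         (real_jordan_banach_triple tpF \<and>
            generalised_triple_homomorphism scaleR (spin_triple scS ip cj) scaleR tpF T)"
  shows "continuous_on UNIV T"
proof -
  interpret S: spin_factor scS ip cj by fact
  \<comment> \<open>Complex and real targets are merged here: from now on \<open>T\<close> is
    treated as real-linear.\<close>
  have T: "linear T"
    using assms(3)
  proof
    assume *: "complex_jordan_banach_triple scF tpF \<and>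
      generalised_triple_homomorphism scS (spin_triple scS ip cj) scF tpF T"
    then interpret F: complex_jordan_banach_triple scF tpF
      by simp
    show ?thesis
      using * complex_linear_imp_linear[OF S.complex_banach_space_axioms F.complex_banach_space_axioms]
      by (simp add: generalised_triple_homomorphism_def)
  qed (simp add: generalised_triple_homomorphism_def linear_def)
  have "jordan_banach_triple_base tpF"
    using assms(3) complex_jordan_banach_triple.axioms(2) real_jordan_banach_triple.axioms(1)
    by blast
  then have cont: "continuous_on UNIV (\<lambda>(a, b, c). tpF a b c)"
    by (rule jordan_banach_triple_base.tp_continuous)
  obtain C where C: "\<And>a b c. norm (T (spin_triple scS ip cj a b c) - tpF (T a) (T b) (T c))
      \<le> C * norm a * norm b * norm c"
    using assms(3) unfolding generalised_triple_homomorphism_def by blast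
  have "bounded_linear T"
    using S.separating_space_trivial[OF T assms(2) cont C] by (intro closed_graph[OF T])
  then show ?thesis
    by (simp add: linear_continuous_on)
qed

end
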